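(* Let $G$ be a connected graph and $H$ a graph. Then $G\circ H$ has a total $[1,2]$-set if and only if at least one of the following holds: (1) $G=K_1$ and $H$ has a total $[1,2]$-set; (2) $G$ has a total $[1,2]$-set $S$ such that, if some vertex $v\in S$ satisfies $|N_G(v)\cap S|=2$, then $H$ has an isolated vertex; (3) $G$ has an efficient dominating set and $\gamma_{t[1,2]}(H)=2$; (4) $\mathcal{SD}^1_{[1,2]}(G)\neq\emptyset$ and $\gamma_{t[1,2]}(H)=2$.
   Context: All graphs are finite and simple; $N_X(x)$ is the open neighborhood of $x$ in $X$. The lexicographic product $G\circ H$ has vertex set $V(G)\times V(H)$, and $(g,h)$ is adjacent to $(g',h')$ iff either $\{g,g'\}\in E(G)$, or $g=g'$ and $\{h,h'\}\in E(H)$. A set $S\subseteq V(X)$ is a total $[1,2]$-set of $X$ if every vertex $x$ of $X$ satisfies $1\le |N_X(x)\cap S|\le 2$; $\gamma_{t[1,2]}(X)$ is the minimum cardinality of a total $[1,2]$-set (when one exists). A set $S$ is a $[1,2]$-set if every $x\notin S$ satisfies $1\le|N_X(x)\cap S|\le 2$; it is $1$-dependent if every $x\in S$ satisfies $|N_X(x)\cap S|\le 1$. $\mathcal{SD}^1_{[1,2]}(G)$ is the family of all $1$-dependent $[1,2]$-sets $S$ of $G$ such that for every $v\in S$ with $|N_G(v)\cap S|=0$, every $v'\in S\setminus\{v\}$ satisfies $\mathrm{dist}_G(v,v')\ge 3$. An efficient dominating set of $G$ is a set $S$ such that every $v\notin S$ has exactly one neighbor in $S$ and every $v\in S$ has no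 neighbor in $S$. *)

theory Defs
  imports "Graph_Theory.Graph_Theory" "HOL-Library.Extended_Nat"
begin

text \<open>
  A finite simple graph is a \<^locale>\<open>pair_graph\<close>: an edge \<open>{u, v}\<close> is represented by the two
  arcs \<open>(u, v)\<close> and \<open>(v, u)\<close>.
\<close>

definition nbhd :: "'a pair_pre_digraph \<Rightarrow> 'a \<Rightarrow> 'a set" where
  "nbhd X x = {y. (x, y) \<in> parcs X}"

definition isolated_vertex :: "'a pair_pre_digraph \<Rightarrow> 'a \<Rightarrow> bool" where
  "isolated_vertex X x \<longleftrightarrow> x \<in> pverts X \<and> nbhd X x = {}"

definition lex_product ::
    "'a pair_pre_digraph \<Rightarrow> 'b pair_pre_digraph \<Rightarrow> ('a \<times> 'b) pair_pre_digraph" where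
  "lex_product G H = \<lparr>
     pverts = pverts G \<times> pverts H,
     parcs = {((g, h), (g', h')) | g h g' h'.
       g \<in> pverts G \<and> g' \<in> pverts G \<and> h \<in> pverts H \<and> h' \<in> pverts H \<and>
       ((g, g') \<in> parcs G \<or> g = g' \<and> (h, h') \<in> parcs H)} \<rparr>"

lemma pair_graph_lex_product:
  assumes "pair_graph G" and "pair_graph H"
  shows "pair_graph (lex_product G H)"
proof -
  interpret G: pair_graph G by fact
  interpret H: pair_graph H by fact
  have arcs: "parcs (lex_product G H) \<subseteq> (pverts G \<times> pverts H) \<times> (pverts G \<times> pverts H)"
    by (auto simp: lex_product_def)
  have verts: "finite (pverts (lex_product G H))"
    by (simp add: lex_product_def G.pair_finite_verts H.pair_finite_verts)
  have "finite (parcs (lex_product G H))"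
    using arcs by (rule finite_subset) (simp add: G.pair_finite_verts H.pair_finite_verts)
  moreover have "symmetric (with_proj (lex_product G H))"
    unfolding symmetric_def
    by (auto intro!: symI simp: lex_product_def dest: G.arcs_symmetric H.arcs_symmetric)
  ultimately show ?thesis
    using verts
    by unfold_locales (auto simp: lex_product_def dest: G.no_loops' H.no_loops')
qed

text \<open>
  The library's weighted distance with all arc weights equal to 1; it is \<open>\<infinity>\<close> if there is no walk.
\<close>

definition graph_dist :: "'a pair_pre_digraph \<Rightarrow> 'a \<Rightarrow> 'a \<Rightarrow> ereal" where
  "graph_dist X u v = wf_digraph.\<mu> (with_proj X) (\<lambda>_. 1) u v"

definition total_12_set :: "'a pair_pre_digraph \<Rightarrow> 'a set \<Rightarrow> bool" where
  "total_12_set X S \<longleftrightarrow> S \<subseteq> pverts X \<and>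
     (\<forall>x \<in> pverts X. 1 \<le> card (nbhd X x \<inter> S) \<and> card (nbhd X x \<inter> S) \<le> 2)"

text \<open>The value is \<open>\<infinity>\<close> if there is no total [1,2]-set.\<close>

definition gamma_t12 :: "'a pair_pre_digraph \<Rightarrow> enat" where
  "gamma_t12 X = (INF S \<in> {S. total_12_set X S}. enat (card S))"

definition set_12 :: "'a pair_pre_digraph \<Rightarrow> 'a set \<Rightarrow> bool" where
  "set_12 X S \<longleftrightarrow> S \<subseteq> pverts X \<and>
     (\<forall>x \<in> pverts X - S. 1 \<le> card (nbhd X x \<inter> S) \<and> card (nbhd X x \<inter> S) \<le> 2)"

definition one_dependent :: "'a pair_pre_digraph \<Rightarrow> 'a set \<Rightarrow> bool" where
  "one_dependent X S \<longleftrightarrow> S \<subseteq> pverts X \<and> (\<forall>x \<in> S. card (nbhd X x \<inter> S) \<le> 1)"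

definition SD_12 :: "'a pair_pre_digraph \<Rightarrow> 'a set set" where
  "SD_12 X = {S. set_12 X S \<and> one_dependent X S \<and>
     (\<forall>v \<in> S. card (nbhd X v \<inter> S) = 0 \<longrightarrow> (\<forall>v' \<in> S - {v}. graph_dist X v v' \<ge> 3))}"

definition efficient_dominating_set :: "'a pair_pre_digraph \<Rightarrow> 'a set \<Rightarrow> bool" where
  "efficient_dominating_set X S \<longleftrightarrow> S \<subseteq> pverts X \<and>
     (\<forall>v \<in> pverts X - S. card (nbhd X v \<inter> S) = 1) \<and>
     (\<forall>v \<in> S. nbhd X v \<inter> S = {})"

end

(* A set D of vertices of the lexicographic product is determined by its shadow S on G and its
   fibres F g over S, and (g, h) has |N_H(h) \<inter> F g| plus the sum of |F g'| over the neighbours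
   g' \<in> S of g as its number of neighbours in D. If every vertex of G has a neighbour in S, then
   S is a total [1,2]-set of G, and two neighbours in S of some v \<in> S leave no room for a neighbour
   in F v, so the elements of F v are isolated. Otherwise some fibre is a total [1,2]-set of H, it
   must have exactly two elements, and S is in SD. Condition (3) is absorbed by (4), since an
   efficient dominating set has pairwise distances at least 3. *)

theory Submission
  imports Defs
begin

section \<open>Neighbourhoods, distance and connectedness\<close>

lemma (in pair_graph) finite_nbhd: "finite (nbhd G x)"
  using pair_finite_verts by (rule finite_subset[rotated]) (auto simp: nbhd_def dest: in_arcsD2)

lemma (in pair_graph) nbhd_in_verts: "y \<in> nbhd G x \<Longrightarrow> y \<in> pverts G"
  by (auto simp: nbhd_def dest: in_arcsD2)

lemma (in pair_graph) nbhd_sym: "y \<in> nbhd G x \<longleftrightarrow> x \<in> nbhd G y"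
  by (auto simp: nbhd_def dest: arcs_symmetric)

lemma (in pair_graph) nbhd_irrefl: "x \<notin> nbhd G x"
  by (auto simp: nbhd_def dest: no_loops')

text \<open>With unit weights a walk costs its length, so the distance bound excludes walks of
  length 0, 1 and 2: equal endpoints, an arc, or a common neighbour.\<close>

lemma (in pair_graph) three_le_graph_dist_iff:
  assumes "v \<in> pverts G" and "v \<noteq> v'"
  shows "3 \<le> graph_dist G v v' \<longleftrightarrow> v' \<notin> nbhd G v \<and> nbhd G v \<inter> nbhd G v' = {}"
proof -
  have cost: "awalk_cost (\<lambda>_. 1) p = real (length p)" for p
    by (induction p) auto
  have iff: "3 \<le> graph_dist G v v' \<longleftrightarrow> (\<forall>p. awalk v p v' \<longrightarrow> 3 \<le> length p)"
    by (simp add: graph_dist_def \<mu>_def le_INF_iff cost)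
  show ?thesis
  proof (intro iffI conjI)
    assume *: "3 \<le> graph_dist G v v'"
    show "v' \<notin> nbhd G v"
    proof
      assume "v' \<in> nbhd G v"
      then have "awalk v [(v, v')] v'"
        using assms by (simp add: awalk_def nbhd_def)
      with * iff have "3 \<le> length [(v, v')]" by blast
      then show False by simp
    qed
    show "nbhd G v \<inter> nbhd G v' = {}"
    proof (rule ccontr)
      assume "nbhd G v \<inter> nbhd G v' \<noteq> {}"
      then obtain x where "x \<in> nbhd G v" "v' \<in> nbhd G x"
        using nbhd_sym by blast
      then have "awalk v [(v, x), (x, v')] v'"
        using assms by (simp add: awalk_def nbhd_def)
      with * iff have "3 \<le> length [(v, x), (x, v')]" by blast
      then show False by simp
    qed
  next
    assume far: "v' \<notin> nbhd G v \<and> nbhd G v \<inter> nbhd G v' = {}"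
    show "3 \<le> graph_dist G v v'"
      unfolding iff
    proof (intro allI impI, rule ccontr)
      fix p
      assume p: "awalk v p v'" and "\<not> 3 \<le> length p"
      \<comment> \<open>\<open>remdups_adj.cases\<close> serves only to split lists into empty,
        singleton and longer ones.\<close>
      then consider "p = []" | e where "p = [e]" | e f where "p = [e, f]"
        by (cases p rule: remdups_adj.cases) (auto simp: not_le less_Suc_eq numeral_3_eq_3)
      then show False
      proof cases
        case 1
        then show False using p \<open>v \<noteq> v'\<close> by (simp add: awalk_def)
      next
        case 2
        then show False using p far by (cases e) (auto simp: awalk_def nbhd_def)
      next
        case 3
        then show False
          using p far by (cases e; cases f) (auto simp: awalk_def nbhd_def dest: arcs_symmetric)
      qed
    qed
  qed
qed

text \<open>A common neighbour of two members would lie outside \<open>S\<close>, since members have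
  no neighbour in \<open>S\<close>, yet it would have two neighbours in \<open>S\<close>.\<close>

lemma (in pair_graph) efficient_dominating_set_in_SD_12:
  assumes "efficient_dominating_set G S"
  shows "S \<in> SD_12 G"
proof -
  have sub: "S \<subseteq> pverts G"
    and one: "\<And>v. v \<in> pverts G - S \<Longrightarrow> card (nbhd G v \<inter> S) = 1"
    and none: "\<And>v. v \<in> S \<Longrightarrow> nbhd G v \<inter> S = {}"
    using assms by (auto simp: efficient_dominating_set_def)
  have "3 \<le> graph_dist G v v'" if v: "v \<in> S" "v' \<in> S" "v \<noteq> v'" for v v'
  proof -
    have "nbhd G v \<inter> nbhd G v' = {}"
    proof (rule ccontr)
      assume "nbhd G v \<inter> nbhd G v' \<noteq> {}"
      then obtain x where x: "x \<in> nbhd G v" "x \<in> nbhd G v'" by blast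
      then have "x \<in> pverts G - S"
        using none[OF v(1)] nbhd_in_verts by blast
      then obtain y where "nbhd G x \<inter> S = {y}"
        using one card_1_singletonE by metis
      moreover have "{v, v'} \<subseteq> nbhd G x \<inter> S"
        using x v nbhd_sym by blast
      ultimately show False using v(3) by auto
    qed
    then show ?thesis
      using v sub none[OF v(1)] three_le_graph_dist_iff by blast
  qed
  then show ?thesis
    using sub one none by (auto simp: SD_12_def set_12_def one_dependent_def)
qed

text \<open>Away from the one-vertex graph there is a second vertex, and the first arc of a walk to
  it yields a neighbour.\<close>

lemma (in pair_graph) connected_imp_nbhd_ne:
  assumes conn: "Digraph_Component.connected (with_proj G)"
    and "\<not> complete_digraph 1 (with_proj G)" and x: "x \<in> pverts G"
  shows "nbhd G x \<noteq> {}"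
proof -
  have "pverts G \<noteq> {x}"
    using assms(2) no_loops' in_arcsD1 in_arcsD2
    by (fastforce simp: complete_digraph_pair_def)
  then obtain y where y: "y \<in> pverts G" "y \<noteq> x" using x by blast
  have "strongly_connected (with_proj G)"
    using conn by (intro symmetric_connected_imp_strongly_connected) (auto intro: sym_arcs)
  then have "x \<rightarrow>\<^sup>*\<^bsub>with_proj G\<^esub> y"
    using x y by (auto simp: strongly_connected_def)
  then show ?thesis
    using y(2) by (cases rule: converse_reachable_cases) (auto simp: nbhd_def)
qed

section \<open>The value 2 of \<open>gamma_t12\<close>\<close>

lemma (in pair_graph) two_le_card_total_12_set:
  assumes "total_12_set G T" and "pverts G \<noteq> {}"
  shows "2 \<le> card T"
proof -
  have T: "T \<subseteq> pverts G" and ne: "\<And>x. x \<in> pverts G \<Longrightarrow> nbhd G x \<inter> T \<noteq> {}"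
    using assms(1) by (fastforce simp: total_12_set_def)+
  obtain a where a: "a \<in> T" using ne assms(2) by blast
  then obtain b where b: "b \<in> nbhd G a" "b \<in> T" using ne T by blast
  then have "a \<noteq> b" using nbhd_irrefl by blast
  have "card {a, b} \<le> card T"
    using a b T pair_finite_verts by (intro card_mono) (auto intro: finite_subset)
  with \<open>a \<noteq> b\<close> show ?thesis by simp
qed

lemma (in pair_graph) gamma_t12_eq_2_iff:
  assumes "pverts G \<noteq> {}"
  shows "gamma_t12 G = 2 \<longleftrightarrow> (\<exists>T. total_12_set G T \<and> card T = 2)"
proof
  assume *: "gamma_t12 G = 2"
  let ?A = "(\<lambda>S. enat (card S)) ` {S. total_12_set G S}"
  \<comment> \<open>An empty infimum would be \<infinity>; a nonempty one is attained because
    \<open>enat\<close> is well-ordered.\<close>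
  have "?A \<noteq> {}"
    using * by (auto simp: gamma_t12_def Inf_enat_def split: if_splits)
  then have "gamma_t12 G \<in> ?A"
    unfolding gamma_t12_def ex_in_conv[symmetric] by (blast intro: wellorder_InfI)
  with * show "\<exists>T. total_12_set G T \<and> card T = 2"
    by (auto simp: numeral_eq_enat)
next
  assume "\<exists>T. total_12_set G T \<and> card T = 2"
  then obtain T where T: "total_12_set G T" "card T = 2" by blast
  show "gamma_t12 G = 2"
  proof (rule antisym)
    show "gamma_t12 G \<le> 2"
      using T unfolding gamma_t12_def
      by (intro INF_lower2[of T]) (auto simp: numeral_eq_enat)
    show "2 \<le> gamma_t12 G"
      using two_le_card_total_12_set assms unfolding gamma_t12_def
      by (intro INF_greatest) (auto simp: numeral_eq_enat)
  qed
qed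

section \<open>Counting neighbours in the lexicographic product\<close>

text \<open>A vertex sees the whole fibre over each neighbour of \<open>g\<close> in
  \<open>S\<close>, and inside its own fibre what \<open>H\<close> lets it see. The two parts are
  disjoint because \<open>g\<close> is not its own neighbour.\<close>

lemma card_nbhd_lex_product:
  assumes "pair_graph G" and "pair_graph H"
    and "g \<in> pverts G" and "h \<in> pverts H" and "\<And>x. x \<in> S \<Longrightarrow> F x \<subseteq> pverts H"
  shows "card (nbhd (lex_product G H) (g, h) \<inter> Sigma S F) =
    (\<Sum>x\<in>nbhd G g \<inter> S. card (F x)) + (if g \<in> S then card (nbhd H h \<inter> F g) else 0)"
proof -
  interpret G: pair_graph G by fact
  interpret H: pair_graph H by fact
  let ?A = "Sigma (nbhd G g \<inter> S) F"
  let ?B = "if g \<in> S then {g} \<times> (nbhd H h \<inter> F g) else {}"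
  have fin: "finite (F x)" if "x \<in> S" for x
    using assms(5)[OF that] H.pair_finite_verts by (rule finite_subset)
  have "nbhd (lex_product G H) (g, h) \<inter> Sigma S F = ?A \<union> ?B"
    using assms(3-5) G.nbhd_in_verts[of _ g] H.nbhd_in_verts[of _ h]
    by (auto simp: nbhd_def lex_product_def subset_iff)
  moreover have "card (?A \<union> ?B) = card ?A + card ?B"
    using G.finite_nbhd H.finite_nbhd fin G.nbhd_irrefl
    by (intro card_Un_disjoint) (auto split: if_splits)
  ultimately show ?thesis
    using G.finite_nbhd fin by (simp add: card_cartesian_product)
qed

lemma total_12_set_lex_product_iff:
  assumes "pair_graph G" and "pair_graph H"
    and "S \<subseteq> pverts G" and "\<And>x. x \<in> S \<Longrightarrow> F x \<subseteq> pverts H"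
  shows "total_12_set (lex_product G H) (Sigma S F) \<longleftrightarrow>
    (\<forall>g \<in> pverts G. \<forall>h \<in> pverts H.
      (\<Sum>x\<in>nbhd G g \<inter> S. card (F x)) + (if g \<in> S then card (nbhd H h \<inter> F g) else 0) \<in> {1..2})"
proof -
  have "Sigma S F \<subseteq> pverts (lex_product G H)"
    using assms(3,4) by (fastforce simp: lex_product_def)
  moreover have "pverts (lex_product G H) = pverts G \<times> pverts H"
    by (simp add: lex_product_def)
  ultimately show ?thesis
    using card_nbhd_lex_product[OF assms(1,2) _ _ assms(4)]
    by (simp add: total_12_set_def)
qed

section \<open>From a total [1,2]-set of the product to its shadow and fibres\<close>

lemma total_12_set_lex_product_shadow:
  assumes "pair_graph G" and "pair_graph H" and "pverts H \<noteq> {}"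
    and no_isolated: "\<And>x. x \<in> pverts G \<Longrightarrow> nbhd G x \<noteq> {}"
    and S: "S \<subseteq> pverts G" and F: "\<And>x. x \<in> S \<Longrightarrow> F x \<subseteq> pverts H" "\<And>x. x \<in> S \<Longrightarrow> F x \<noteq> {}"
    and tot: "total_12_set (lex_product G H) (Sigma S F)"
  shows "(total_12_set G S \<and>
      ((\<exists>v \<in> S. card (nbhd G v \<inter> S) = 2) \<longrightarrow> (\<exists>h. isolated_vertex H h))) \<or>
    (S \<in> SD_12 G \<and> gamma_t12 H = 2)"
proof -
  interpret G: pair_graph G by fact
  interpret H: pair_graph H by fact
  let ?w = "\<lambda>g. \<Sum>x\<in>nbhd G g \<inter> S. card (F x)"
  have fin: "finite (nbhd G g \<inter> S)" for g
    using G.finite_nbhd by blast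
  have cF: "1 \<le> card (F x)" if "x \<in> S" for x
    using F[OF that] H.pair_finite_verts by (simp add: Suc_le_eq card_gt_0_iff finite_subset)
  have range: "?w g + (if g \<in> S then card (nbhd H h \<inter> F g) else 0) \<in> {1..2}"
    if "g \<in> pverts G" "h \<in> pverts H" for g h
    using iffD1[OF total_12_set_lex_product_iff[OF assms(1,2) S F(1)] tot] that by blast
  have w2: "?w g \<le> 2" if "g \<in> pverts G" for g
    using range[OF that] assms(3) by fastforce
  \<comment> \<open>Fibres over \<open>S\<close> are nonempty, so each contributes at least 1 to the
    weight \<open>?w g\<close>.\<close>
  have card_le_w: "card (nbhd G g \<inter> S) \<le> ?w g" for g
    using sum_mono[of "nbhd G g \<inter> S" "\<lambda>_. 1" "\<lambda>x. card (F x)"] cF by simp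
  \<comment> \<open>Two neighbours in \<open>S\<close> already use up the bound 2, so no vertex of
    \<open>H\<close> may have a neighbour in \<open>F v\<close>.\<close>
  have isolated: "isolated_vertex H h"
    if v: "v \<in> S" "2 \<le> card (nbhd G v \<inter> S)" and h: "h \<in> F v" for v h
  proof -
    have "nbhd H h' \<inter> F v = {}" if h': "h' \<in> pverts H" for h'
    proof -
      have "card (nbhd H h' \<inter> F v) = 0"
        using range[of v h'] card_le_w[of v] v S h' by (auto simp: subset_iff)
      then show ?thesis using H.finite_nbhd by simp
    qed
    then show ?thesis
      using h F(1)[OF v(1)] H.nbhd_sym H.nbhd_in_verts
      by (fastforce simp: isolated_vertex_def)
  qed
  show ?thesis
  proof (cases "\<forall>g\<in>pverts G. nbhd G g \<inter> S \<noteq> {}")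
    case True
    have "card (nbhd G g \<inter> S) \<le> 2" if "g \<in> pverts G" for g
      using card_le_w[of g] w2[OF that] by simp
    then have "total_12_set G S"
      using True S fin by (simp add: total_12_set_def Suc_le_eq card_gt_0_iff)
    moreover have "\<exists>h. isolated_vertex H h" if "v \<in> S" "card (nbhd G v \<inter> S) = 2" for v
      using isolated[OF that(1)] F(2)[OF that(1)] that(2) by auto
    ultimately show ?thesis by blast
  next
    case False
    \<comment> \<open>Any neighbour \<open>x\<close> of \<open>v\<close> sees all of
      \<open>F v\<close>, so \<open>?w x\<close> bounds its size.\<close>
    have small: "card (F v) \<le> 2" if v: "v \<in> S" for v
    proof -
      obtain x where x: "x \<in> nbhd G v" using no_isolated v S by blast
      then have "v \<in> nbhd G x \<inter> S" using v G.nbhd_sym by blast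
      then have "card (F v) \<le> ?w x" using fin by (intro member_le_sum) auto
      then show ?thesis using w2 x G.nbhd_in_verts by (meson le_trans)
    qed
    \<comment> \<open>Here \<open>?w v\<close> is an empty sum, so the count inside the fibre alone
      must lie in \<open>{1..2}\<close> for every vertex of \<open>H\<close>. This forces
      \<open>v \<in> S\<close> and makes the fibre total.\<close>
    have fibre: "v \<in> S" "total_12_set H (F v)" "card (F v) = 2"
      if v: "v \<in> pverts G" "nbhd G v \<inter> S = {}" for v
    proof -
      show vS: "v \<in> S"
        using range[OF v(1)] v(2) assms(3) by (auto split: if_splits)
      show "total_12_set H (F v)"
        using range[OF v(1)] v(2) vS F(1)[OF vS] by (auto simp: total_12_set_def)
      then show "card (F v) = 2"
        using H.two_le_card_total_12_set assms(3) small[OF vS] by (simp add: antisym)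
    qed
    obtain v0 where v0: "v0 \<in> pverts G" "nbhd G v0 \<inter> S = {}" using False by blast
    \<comment> \<open>A total fibre rules out isolated vertices of \<open>H\<close>; by
      \<open>isolated\<close>, no member of \<open>S\<close> then has two neighbours in
      \<open>S\<close>.\<close>
    have no_iso: "\<not> isolated_vertex H h" for h
      using fibre(2)[OF v0] by (fastforce simp: total_12_set_def isolated_vertex_def)
    have "set_12 G S"
      using fibre(1) card_le_w w2 S fin
      by (fastforce simp: set_12_def Suc_le_eq card_gt_0_iff intro: le_trans)
    moreover have "one_dependent G S"
      using isolated no_iso F(2) S by (fastforce simp: one_dependent_def not_less_eq_eq)
    moreover have "3 \<le> graph_dist G v v'"
      if v: "v \<in> S" "card (nbhd G v \<inter> S) = 0" and v': "v' \<in> S" "v' \<noteq> v" for v v'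
    proof -
      have empty: "nbhd G v \<inter> S = {}" using v(2) fin by simp
      \<comment> \<open>A common neighbour would see the two elements of \<open>F v\<close> and at
        least one of \<open>F v'\<close>, hence three in all.\<close>
      have "nbhd G v \<inter> nbhd G v' = {}"
      proof (rule ccontr)
        assume "nbhd G v \<inter> nbhd G v' \<noteq> {}"
        then obtain x where x: "x \<in> nbhd G v" "x \<in> nbhd G v'" by blast
        then have "{v, v'} \<subseteq> nbhd G x \<inter> S" using v v' G.nbhd_sym by blast
        then have "(\<Sum>y\<in>{v, v'}. card (F y)) \<le> ?w x" using fin by (intro sum_mono2) auto
        moreover have "?w x \<le> 2" using x G.nbhd_in_verts by (intro w2) blast
        moreover have "card (F v) = 2" using v(1) S empty by (intro fibre(3)) auto
        ultimately show False using v'(2) cF[OF v'(1)] by simp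
      qed
      moreover have "v \<in> pverts G" "v' \<notin> nbhd G v"
        using v(1) v'(1) S empty by blast+
      ultimately show ?thesis
        using G.three_le_graph_dist_iff[of v v'] v'(2) by simp
    qed
    ultimately have "S \<in> SD_12 G" by (simp add: SD_12_def)
    moreover have "gamma_t12 H = 2"
      using fibre(2,3)[OF v0] H.gamma_t12_eq_2_iff assms(3) by blast
    ultimately show ?thesis by blast
  qed
qed

section \<open>Total [1,2]-sets of the product built from the factors\<close>

text \<open>Over a single vertex the sum over neighbours is empty, and the product is a copy of
  \<open>H\<close>.\<close>

lemma total_12_set_lex_product_K1:
  assumes "pair_graph G" and "pair_graph H" and "complete_digraph 1 (with_proj G)"
  shows "(\<exists>D. total_12_set (lex_product G H) D) \<longleftrightarrow> (\<exists>T. total_12_set H T)"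
proof -
  interpret G: pair_graph G by fact
  have "card (pverts G) = 1"
    using assms(3) by (simp add: complete_digraph_pair_def)
  then obtain g where g: "pverts G = {g}" by (rule card_1_singletonE)
  then have N: "nbhd G g = {}"
    using G.nbhd_in_verts[of _ g] G.nbhd_irrefl[of g] by auto
  have iff: "total_12_set (lex_product G H) ({g} \<times> T) \<longleftrightarrow> total_12_set H T"
    if "T \<subseteq> pverts H" for T
    using that g N total_12_set_lex_product_iff[OF assms(1,2), of "{g}" "\<lambda>_. T"]
    by (simp add: total_12_set_def)
  show ?thesis
  proof
    assume "\<exists>D. total_12_set (lex_product G H) D"
    then obtain D where D: "total_12_set (lex_product G H) D" by blast
    then have "D \<subseteq> {g} \<times> pverts H"
      using g by (simp add: total_12_set_def lex_product_def)
    then have "D = {g} \<times> snd ` D" "snd ` D \<subseteq> pverts H" by force+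
    then show "\<exists>T. total_12_set H T" using D iff by metis
  next
    assume "\<exists>T. total_12_set H T"
    then show "\<exists>D. total_12_set (lex_product G H) D"
      using iff by (auto simp: total_12_set_def[of H])
  qed
qed

text \<open>One copy of \<open>S\<close> at a fixed level \<open>k\<close> of \<open>H\<close>
  suffices: neighbours in \<open>S\<close> supply the lower bound, and only the count inside the own
  fibre could exceed 2.\<close>

lemma total_12_set_lex_product_of_total:
  assumes "pair_graph G" and "pair_graph H" and "pverts H \<noteq> {}" and S: "total_12_set G S"
    and iso: "(\<exists>v \<in> S. card (nbhd G v \<inter> S) = 2) \<Longrightarrow> \<exists>h. isolated_vertex H h"
  shows "\<exists>D. total_12_set (lex_product G H) D"
proof -
  interpret H: pair_graph H by fact
  \<comment> \<open>\<open>k\<close> is isolated if some member of \<open>S\<close> has two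
    neighbours in \<open>S\<close>, and arbitrary otherwise.\<close>
  obtain k where k: "k \<in> pverts H"
      "(\<exists>v \<in> S. card (nbhd G v \<inter> S) = 2) \<Longrightarrow> isolated_vertex H k"
    using iso assms(3) by (metis ex_in_conv isolated_vertex_def)
  have sub: "S \<subseteq> pverts G"
    and range: "\<And>g. g \<in> pverts G \<Longrightarrow> card (nbhd G g \<inter> S) \<in> {1..2}"
    using S by (auto simp: total_12_set_def)
  have "card (nbhd G g \<inter> S) + (if g \<in> S then card (nbhd H h \<inter> {k}) else 0) \<in> {1..2}"
    if g: "g \<in> pverts G" for g h
  proof (cases "g \<in> S \<and> card (nbhd G g \<inter> S) = 2")
    case True
    then have "nbhd H h \<inter> {k} = {}"
      using k(2) H.nbhd_sym by (auto simp: isolated_vertex_def)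
    then show ?thesis using range[OF g] by simp
  next
    case False
    moreover have "card (nbhd H h \<inter> {k}) \<le> 1"
      using card_mono[of "{k}" "nbhd H h \<inter> {k}"] by simp
    ultimately show ?thesis using range[OF g] by auto
  qed
  then have "total_12_set (lex_product G H) (S \<times> {k})"
    using k(1) sub by (subst total_12_set_lex_product_iff[OF assms(1,2)]) auto
  then show ?thesis by blast
qed

text \<open>Members of \<open>S\<close> without a neighbour in \<open>S\<close> need a whole copy of
  \<open>T\<close> to be dominated within their own fibre; for all others a single point is
  enough.\<close>

lemma total_12_set_lex_product_of_SD_12:
  assumes "pair_graph G" and "pair_graph H" and S: "S \<in> SD_12 G"
    and T: "total_12_set H T" "card T = 2"
  shows "\<exists>D. total_12_set (lex_product G H) D"
proof -
  interpret G: pair_graph G by fact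
  interpret H: pair_graph H by fact
  obtain t where t: "t \<in> T" using T(2) by fastforce
  have T': "T \<subseteq> pverts H" "\<And>h. h \<in> pverts H \<Longrightarrow> card (nbhd H h \<inter> T) \<in> {1..2}"
    using T(1) by (auto simp: total_12_set_def)
  define F where "F v = (if nbhd G v \<inter> S = {} then T else {t})" for v
  have fin: "finite (nbhd G g \<inter> S)" for g
    using G.finite_nbhd by blast
  have sub: "S \<subseteq> pverts G"
    and out: "\<And>g. g \<in> pverts G - S \<Longrightarrow> card (nbhd G g \<inter> S) \<in> {1..2}"
    and dep: "\<And>g. g \<in> S \<Longrightarrow> card (nbhd G g \<inter> S) \<le> 1"
    using S by (auto simp: SD_12_def set_12_def one_dependent_def)
  have far: "nbhd G v \<inter> nbhd G v' = {}"
    if "v \<in> S" "nbhd G v \<inter> S = {}" "v' \<in> S" "v' \<noteq> v" for v v'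
  proof -
    have "3 \<le> graph_dist G v v'" using S that by (auto simp: SD_12_def)
    moreover have "v \<in> pverts G" using that(1) sub by blast
    ultimately show ?thesis using G.three_le_graph_dist_iff[of v v'] that(4) by simp
  qed
  have F_one: "card (F x) = 1" if "nbhd G x \<inter> S \<noteq> {}" for x
    using that by (simp add: F_def)
  have "(\<Sum>x\<in>nbhd G g \<inter> S. card (F x)) + (if g \<in> S then card (nbhd H h \<inter> F g) else 0) \<in> {1..2}"
    if g: "g \<in> pverts G" and h: "h \<in> pverts H" for g h
  proof (cases "g \<in> S")
    case gS: True
    show ?thesis
    proof (cases "nbhd G g \<inter> S = {}")
      case True
      then show ?thesis using gS T'(2)[OF h] by (simp add: F_def)
    next
      case False
      \<comment> \<open>Each such \<open>x\<close> has \<open>g\<close> as a neighbour in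
        \<open>S\<close>, so its fibre is \<open>{t}\<close>. By 1-dependence the sum is 1, leaving
        room for \<open>t\<close> in the fibre of \<open>g\<close>.\<close>
      have "(\<Sum>x\<in>nbhd G g \<inter> S. card (F x)) = (\<Sum>x\<in>nbhd G g \<inter> S. 1)"
        using gS G.nbhd_sym by (intro sum.cong F_one) blast+
      also have "\<dots> = 1"
        using dep[OF gS] False fin by (simp add: le_antisym Suc_le_eq card_gt_0_iff)
      finally have "(\<Sum>x\<in>nbhd G g \<inter> S. card (F x)) = 1" .
      moreover have "card (nbhd H h \<inter> F g) \<le> 1"
        using card_mono[of "{t}" "nbhd H h \<inter> F g"] False by (auto simp: F_def)
      ultimately show ?thesis using gS by simp
    qed
  next
    case gS: False
    show ?thesis
    proof (cases "\<exists>v \<in> nbhd G g \<inter> S. nbhd G v \<inter> S = {}")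
      case True
      then obtain v where v: "v \<in> nbhd G g \<inter> S" "nbhd G v \<inter> S = {}" by blast
      \<comment> \<open>The distance condition makes \<open>v\<close> the only neighbour of
        \<open>g\<close> in \<open>S\<close>, so the count is \<open>card T = 2\<close>.\<close>
      then have "nbhd G g \<inter> S = {v}"
        using far[of v] G.nbhd_sym by blast
      then show ?thesis using gS v(2) T(2) by (simp add: F_def)
    next
      case False
      \<comment> \<open>All fibres seen from \<open>g\<close> are singletons, so the [1,2]-property
        of \<open>S\<close> gives the count.\<close>
      then have "(\<Sum>x\<in>nbhd G g \<inter> S. card (F x)) = (\<Sum>x\<in>nbhd G g \<inter> S. 1)"
        by (intro sum.cong F_one) auto
      then show ?thesis using gS out g by simp
    qed
  qed
  moreover have "F x \<subseteq> pverts H" for x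
    using t T'(1) by (auto simp: F_def)
  ultimately have "total_12_set (lex_product G H) (Sigma S F)"
    using sub by (subst total_12_set_lex_product_iff[OF assms(1,2)]) auto
  then show ?thesis by blast
qed

section \<open>Combining the cases of the equivalence\<close>

theorem theorem4p10:
  fixes G :: "'a pair_pre_digraph" and H :: "'b pair_pre_digraph"
  assumes "pair_graph G" and "Digraph_Component.connected (with_proj G)"
    and "pair_graph H" and "pverts H \<noteq> {}"
  shows "(\<exists>D. total_12_set (lex_product G H) D) \<longleftrightarrow>
      (complete_digraph 1 (with_proj G) \<and> (\<exists>T. total_12_set H T)) \<or>
      (\<exists>S. total_12_set G S \<and>
        ((\<exists>v \<in> S. card (nbhd G v \<inter> S) = 2) \<longrightarrow> (\<exists>h. isolated_vertex H h))) \<or>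
      ((\<exists>S. efficient_dominating_set G S) \<and> gamma_t12 H = 2) \<or>
      (SD_12 G \<noteq> {} \<and> gamma_t12 H = 2)"
    (is "?lex \<longleftrightarrow> ?K1 \<or> ?total \<or> ?efficient \<or> ?SD")
proof
  assume ?lex
  then obtain D where D: "total_12_set (lex_product G H) D" by blast
  show "?K1 \<or> ?total \<or> ?efficient \<or> ?SD"
  proof (cases "complete_digraph 1 (with_proj G)")
    case True
    then show ?thesis
      using \<open>?lex\<close> total_12_set_lex_product_K1[OF assms(1,3)] by blast
  next
    case False
    \<comment> \<open>Read as a relation, \<open>D\<close> has its domain as shadow and its images
      of single vertices as fibres.\<close>
    have Sigma: "D = Sigma (fst ` D) (\<lambda>g. D `` {g})" by force
    have "D \<subseteq> pverts G \<times> pverts H"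
      using D by (simp add: total_12_set_def lex_product_def)
    then have "fst ` D \<subseteq> pverts G" "\<And>x. D `` {x} \<subseteq> pverts H" by auto
    moreover have "D `` {x} \<noteq> {}" if "x \<in> fst ` D" for x using that by auto
    ultimately have "?total \<or> ?SD"
      using total_12_set_lex_product_shadow[OF assms(1,3,4)
          pair_graph.connected_imp_nbhd_ne[OF assms(1,2) False],
          of "fst ` D" "\<lambda>g. D `` {g}"] D Sigma by auto
    then show ?thesis by blast
  qed
next
  assume "?K1 \<or> ?total \<or> ?efficient \<or> ?SD"
  then consider ?K1 | ?total | ?SD
    using pair_graph.efficient_dominating_set_in_SD_12[OF assms(1)] by blast
  then show ?lex
  proof cases
    case 1
    then show ?thesis using total_12_set_lex_product_K1[OF assms(1,3)] by blast
  next
    case 2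
    then show ?thesis using total_12_set_lex_product_of_total[OF assms(1,3,4)] by blast
  next
    case 3
    then show ?thesis
      using total_12_set_lex_product_of_SD_12[OF assms(1,3)]
        pair_graph.gamma_t12_eq_2_iff[OF assms(3,4)] by blast
  qed
qed

end
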